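(* Let $\mu,p\in\mathbb{R}$ be such that neither $\mu+p$ nor $\mu-p$ is a negative odd integer. If $$\frac{3\mu}{2\sqrt{2}}-\sqrt{3}\left|\frac{(\mu+1)^2-p^2}{4}-2\mu-2\right|>\frac{13\sqrt{3}}{4}-\frac{15}{8\sqrt{2}}+\frac{1}{4},$$ then the function $$f_{\mu,p}(z)=\int_0^z\frac{h_{\mu,p}(t)}{t}\,dt,$$ the Alexander transform of the normalized Lommel function $h_{\mu,p}$, is lemniscate convex in $\mathbb{D}$.
   Context: $\mathbb{D}=\{z\in\mathbb{C}:|z|<1\}$. For analytic functions $f,g$ on $\mathbb{D}$, $f\prec g$ ($f$ is subordinate to $g$) means that there is an analytic $w:\mathbb{D}\to\mathbb{D}$ with $w(0)=0$ and $f=g\circ w$. $\sqrt{1+z}$ denotes the principal branch (value $1$ at $z=0$). An analytic function $f$ on $\mathbb{D}$ with $f(0)=0$, $f'(0)=1$ is called lemniscate convex if $1+\frac{zf''(z)}{f'(z)}$ is analytic in $\mathbb{D}$ ($f'$ having no zeros there) and $1+\frac{zf''(z)}{f'(z)}\prec\sqrt{1+z}$. For $\mu\pm p$ not negative odd integers, the normalized Lommel function of the first kind is $$h_{\mu,p}(z)=(\mu-p+1)(\mu+p+1)z^{\frac{1-\mu}{2}}s_{\mu,p}(\sqrt z)=z+\sum_{n=1}^{\infty}\frac{(-1/4)^n}{(K)_n(F)_n}z^{n+1},\qquad K=\frac{\mu-p+3}{2},\ F=\frac{\mu+p+3}{2},$$ where $s_{\mu,p}$ is the Lommel function of the first kind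 and $(\lambda)_n=\lambda(\lambda+1)\cdots(\lambda+n-1)$, $(\lambda)_0=1$. The power series may be taken as the definition of $h_{\mu,p}$. *)

theory Defs
  imports "HOL-Complex_Analysis.Complex_Analysis"
begin

abbreviation unit_disc :: "complex set" where
  "unit_disc \<equiv> ball 0 1"

definition subordinate :: "(complex \<Rightarrow> complex) \<Rightarrow> (complex \<Rightarrow> complex) \<Rightarrow> bool" where
  "subordinate f g \<longleftrightarrow>
     (\<exists>w. w holomorphic_on unit_disc \<and> w ` unit_disc \<subseteq> unit_disc \<and> w 0 = 0 \<and>
          (\<forall>z\<in>unit_disc. f z = g (w z)))"

text \<open>The analyticity of \<open>1 + z f''(z) / f'(z)\<close> has to be accompanied by the condition that
  \<open>f'\<close> has no zeros, since division by zero is total in HOL. The principal square root is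
  \<^const>\<open>csqrt\<close>.\<close>

definition lemniscate_convex :: "(complex \<Rightarrow> complex) \<Rightarrow> bool" where
  "lemniscate_convex f \<longleftrightarrow>
     f holomorphic_on unit_disc \<and> f 0 = 0 \<and> deriv f 0 = 1 \<and>
     (\<forall>z\<in>unit_disc. deriv f z \<noteq> 0) \<and>
     (\<lambda>z. 1 + z * deriv (deriv f) z / deriv f z) holomorphic_on unit_disc \<and>
     subordinate (\<lambda>z. 1 + z * deriv (deriv f) z / deriv f z) (\<lambda>z. csqrt (1 + z))"

definition negative_odd_integer :: "real \<Rightarrow> bool" where
  "negative_odd_integer x \<longleftrightarrow> (\<exists>m::int. odd m \<and> m < 0 \<and> x = of_int m)"

text \<open>The power series of
  \<open>(\<mu> - p + 1) (\<mu> + p + 1) z powr ((1 - \<mu>) / 2) * s (sqrt z)\<close>, where \<open>s\<close> is the Lommel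
  function of the first kind with parameters \<open>\<mu>, p\<close>. The sum starts at exponent 2
  (index shifted by one), and the leading term \<open>z\<close> is written separately.\<close>

definition lommel_h :: "real \<Rightarrow> real \<Rightarrow> complex \<Rightarrow> complex" where
  "lommel_h \<mu> p z =
     z + (\<Sum>n. (- 1 / 4) ^ Suc n /
              (pochhammer (complex_of_real ((\<mu> - p + 3) / 2)) (Suc n) *
               pochhammer (complex_of_real ((\<mu> + p + 3) / 2)) (Suc n)) * z ^ (Suc n + 1))"

text \<open>The integrand takes the value \<open>0\<close> at \<open>t = 0\<close> by the convention \<open>x / 0 = 0\<close>; this single
  point does not affect the integral along the segment from \<open>0\<close> to \<open>z\<close>.\<close>

definition alexander_transform :: "(complex \<Rightarrow> complex) \<Rightarrow> complex \<Rightarrow> complex" where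
  "alexander_transform h z = contour_integral (linepath 0 z) (\<lambda>t. h t / t)"

end

theory Submission
  imports Defs
begin

text \<open>Put \<open>K = (\<mu> - p + 3) / 2\<close> and \<open>F = (\<mu> + p + 3) / 2\<close>. The inequality in the hypothesis
  bounds the distance of \<open>K F\<close> from \<open>3 \<mu> + 4\<close> and yields \<open>\<mu> > 0\<close> and \<open>K F > 4\<close>; since also
  \<open>K + F = \<mu> + 3 > 0\<close>, both \<open>K\<close> and \<open>F\<close> are positive. As \<open>(K)\<^sub>n (F)\<^sub>n \<ge> (K F)\<^sup>n\<close>, the
  \<open>n\<close>-th coefficient of \<open>g z = h z / z\<close> is at most \<open>(1 / 16)\<^sup>n\<close> in modulus, so that
  \<open>\<bar>g - 1\<bar> \<le> 1 / 7\<close> on the disc of radius \<open>2\<close>. Since \<open>f' = g\<close>, Cauchy's estimate gives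
  \<open>\<bar>z f'' / f'\<bar> \<le> 1 / 6\<close> on the unit disc, and \<open>u = 1 + z f'' / f'\<close> then lies well inside the
  region \<open>\<bar>u\<^sup>2 - 1\<bar> < 1\<close>, \<open>Re u > 0\<close>, which is the image of the disc under \<open>sqrt (1 + z)\<close>.\<close>

lemma power_le_pochhammer:
  fixes x :: "'a :: linordered_semidom"
  assumes "0 \<le> x"
  shows "x ^ n \<le> pochhammer x n"
proof (induction n)
  case (Suc n)
  have "x ^ n * x \<le> pochhammer x n * (x + of_nat n)"
    using Suc assms by (intro mult_mono) (auto intro: order_trans[OF zero_le_power])
  then show ?case by (simp add: pochhammer_Suc mult.commute)
qed simp

text \<open>A primitive \<open>G\<close> of \<open>g\<close> exists because the disc is convex.
  Along segments from \<open>0\<close> it evaluates the transform as \<open>G w - G 0\<close>, so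
  the derivative of \<open>G\<close> carries over.\<close>

lemma alexander_transform_has_field_derivative:
  assumes "g holomorphic_on unit_disc"
    and h: "\<And>z. z \<in> unit_disc \<Longrightarrow> h z = z * g z"
    and z: "z \<in> unit_disc"
  shows "(alexander_transform h has_field_derivative g z) (at z)"
proof -
  obtain G where G: "\<And>x. x \<in> unit_disc \<Longrightarrow> (G has_field_derivative g x) (at x within unit_disc)"
    using holomorphic_convex_primitive'[OF _ _ assms(1)] by (auto simp del: mem_ball)
  have transform: "alexander_transform h w = G w - G 0" if w: "w \<in> unit_disc" for w
  proof (cases "w = 0")
    case True
    then show ?thesis by (simp add: alexander_transform_def)
  next
    case False
    have seg: "closed_segment 0 w \<subseteq> unit_disc"
      using w by (intro closed_segment_subset) auto
    have "(g has_contour_integral (G (pathfinish (linepath 0 w)) - G (pathstart (linepath 0 w))))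
        (linepath 0 w)"
      by (rule contour_integral_primitive[OF G]) (use seg in auto)
    then have "((\<lambda>x. g (linepath 0 w x) * w) has_integral (G w - G 0)) {0..1}"
      by (simp add: has_contour_integral_linepath)
    \<comment> \<open>At \<open>x = 0\<close> the path sits at the origin, where
      \<open>h t / t\<close> has the default value \<open>0\<close> instead of \<open>g 0\<close>.
      One point does not change the integral.\<close>
    then have "((\<lambda>x. h (linepath 0 w x) / linepath 0 w x * w) has_integral (G w - G 0)) {0..1}"
    proof (rule has_integral_spike_finite[rotated 2, of _ _ _ "{0}"])
      fix x :: real assume x: "x \<in> {0..1} - {0}"
      have "linepath 0 w x \<in> unit_disc"
        using linepath_in_path[of x 0 w] seg x by auto
      moreover have "linepath 0 w x \<noteq> 0"
        using x False by (auto simp: linepath_def)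
      ultimately show "h (linepath 0 w x) / linepath 0 w x * w = g (linepath 0 w x) * w"
        by (simp only: h nonzero_mult_div_cancel_left not_False_eq_True)
    qed simp
    then have "((\<lambda>t. h t / t) has_contour_integral (G w - G 0)) (linepath 0 w)"
      by (simp add: has_contour_integral_linepath)
    then show ?thesis
      by (simp add: alexander_transform_def contour_integral_unique)
  qed
  have "((\<lambda>w. G w - G 0) has_field_derivative g z) (at z)"
    using G[OF z] z by (auto intro!: derivative_eq_intros simp: at_within_open[OF z])
  then show ?thesis
    by (rule DERIV_cong_ev[THEN iffD1, rotated -1])
       (use z transform in \<open>auto intro!: eventually_mono[OF eventually_nhds_in_open[of unit_disc]]\<close>)
qed

text \<open>Solving \<open>u = csqrt (1 + w)\<close> forces \<open>w = u\<^sup>2 - 1\<close>. With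
  \<open>u\<close> this close to \<open>1\<close>, the modulus of \<open>w\<close> is at most
  \<open>13 / 36\<close>, and \<open>Re u > 0\<close> makes \<open>u\<close> the principal
  root.\<close>

lemma subordinate_csqrtI:
  assumes hol: "u holomorphic_on unit_disc" and "u 0 = 1"
    and bound: "\<And>z. z \<in> unit_disc \<Longrightarrow> norm (u z - 1) \<le> 1 / 6"
  shows "subordinate u (\<lambda>z. csqrt (1 + z))"
  unfolding subordinate_def
proof (intro exI[of _ "\<lambda>z. (u z)\<^sup>2 - 1"] conjI ballI subsetI)
  show "(\<lambda>z. (u z)\<^sup>2 - 1) holomorphic_on unit_disc"
    by (intro holomorphic_intros hol)
next
  fix v assume "v \<in> (\<lambda>z. (u z)\<^sup>2 - 1) ` unit_disc"
  then obtain z where z: "z \<in> unit_disc" and v: "v = (u z - 1) * (2 + (u z - 1))"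
    by (auto simp: power2_eq_square algebra_simps)
  have "norm (2 + (u z - 1)) \<le> 2 + 1 / 6"
    using norm_triangle_ineq[of 2 "u z - 1"] bound[OF z] by simp
  then have "norm v \<le> 1 / 6 * (2 + 1 / 6)"
    unfolding v norm_mult by (intro mult_mono bound z) auto
  then show "v \<in> unit_disc" by simp
next
  fix z :: complex assume z: "z \<in> unit_disc"
  have "\<bar>Re (u z - 1)\<bar> \<le> 1 / 6"
    using abs_Re_le_cmod[of "u z - 1"] bound[OF z] by linarith
  then have "0 < Re (u z)" by (simp add: abs_if split: if_splits)
  then show "u z = csqrt (1 + ((u z)\<^sup>2 - 1))"
    by (simp add: csqrt_square)
qed (use assms in auto)

text \<open>The radius \<open>2\<close> leaves room for a closed disc of radius \<open>1\<close>
  around each point of the unit disc. Cauchy's estimate there bounds \<open>g'\<close> by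
  \<open>1 / 7\<close>; as \<open>g\<close> is at least \<open>6 / 7\<close> in modulus, the
  quotient is at most \<open>1 / 6\<close>.\<close>

lemma lemniscate_convex_alexander_transform:
  assumes hol: "g holomorphic_on ball 0 3" and "g 0 = 1"
    and bound: "\<And>z. z \<in> cball 0 2 \<Longrightarrow> norm (g z - 1) \<le> 1 / 7"
    and h: "\<And>z. z \<in> unit_disc \<Longrightarrow> h z = z * g z"
  shows "lemniscate_convex (alexander_transform h)"
proof -
  let ?f = "alexander_transform h"
  let ?u = "\<lambda>z. 1 + z * deriv (deriv ?f) z / deriv ?f z"
  have hol_disc: "g holomorphic_on unit_disc"
    by (rule holomorphic_on_subset[OF hol]) auto
  have der: "(?f has_field_derivative g z) (at z)" if "z \<in> unit_disc" for z
    using alexander_transform_has_field_derivative[OF hol_disc h] that by blast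
  have f': "deriv ?f z = g z" if "z \<in> unit_disc" for z
    using der that by (auto intro: DERIV_imp_deriv)
  \<comment> \<open>\<open>deriv ?f\<close> is known to equal \<open>g\<close> only on the disc;
    being open, it is a neighbourhood of \<open>z\<close>, which suffices for the
    derivative.\<close>
  have f'': "deriv (deriv ?f) z = deriv g z" if "z \<in> unit_disc" for z
    by (rule deriv_cong_ev)
       (use that f' in \<open>auto intro!: eventually_mono[OF eventually_nhds_in_open[of unit_disc]]\<close>)
  have g_lower: "6 / 7 \<le> norm (g z)" if "z \<in> unit_disc" for z
    using norm_triangle_ineq2[of 1 "1 - g z"] bound[of z] that by (simp add: norm_minus_commute)
  have g_nz: "g z \<noteq> 0" if "z \<in> unit_disc" for z
    using g_lower[OF that] by auto
  have g'_upper: "norm (deriv g z) \<le> 1 / 7" if z: "z \<in> unit_disc" for z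
  proof -
    have near: "y \<in> cball 0 2" if "y \<in> cball z 1" for y
      using norm_triangle_sub[of y z] z that by (simp add: dist_norm norm_minus_commute)
    have hol_g1: "(\<lambda>w. g w - 1) holomorphic_on cball z 1"
      using near by (intro holomorphic_intros holomorphic_on_subset[OF hol]) force
    \<comment> \<open>Subtracting \<open>1\<close> keeps the derivative and lets the small bound
      \<open>1 / 7\<close> enter.\<close>
    have "norm ((deriv ^^ 1) (\<lambda>w. g w - 1) z) \<le> fact 1 * (1 / 7) / 1 ^ 1"
    proof (rule Cauchy_inequality)
      show "(\<lambda>w. g w - 1) holomorphic_on ball z 1"
        by (rule holomorphic_on_subset[OF hol_g1]) auto
      show "continuous_on (cball z 1) (\<lambda>w. g w - 1)"
        by (rule holomorphic_on_imp_continuous_on[OF hol_g1])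
      show "norm (g y - 1) \<le> 1 / 7" if "norm (z - y) = 1" for y
        using that by (intro bound near) (simp add: dist_norm)
    qed simp
    moreover have "deriv (\<lambda>w. g w - 1) z = deriv g z"
      using holomorphic_on_imp_differentiable_at[OF hol_disc] z by simp
    ultimately show ?thesis by simp
  qed
  have "(\<lambda>z. 1 + z * deriv g z / g z) holomorphic_on unit_disc"
    by (intro holomorphic_intros hol_disc) (use g_nz in auto)
  then have u_hol: "?u holomorphic_on unit_disc"
    by (rule holomorphic_transform) (simp add: f' f'')
  have u_bound: "norm (?u z - 1) \<le> 1 / 6" if z: "z \<in> unit_disc" for z
  proof -
    have "norm (?u z - 1) = norm z * norm (deriv g z) / norm (g z)"
      using z by (simp add: f' f'' norm_mult norm_divide)
    also have "\<dots> \<le> (1 * (1 / 7)) / (6 / 7)"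
      using z g'_upper[OF z] g_lower[OF z] by (intro frac_le mult_mono) auto
    finally show ?thesis by simp
  qed
  have "?f holomorphic_on unit_disc"
    using der by (subst holomorphic_on_open) blast+
  moreover have "?f 0 = 0"
    by (simp add: alexander_transform_def)
  moreover have "subordinate ?u (\<lambda>z. csqrt (1 + z))"
    by (intro subordinate_csqrtI u_hol u_bound) auto
  ultimately show ?thesis
    using u_hol g_nz \<open>g 0 = 1\<close> by (simp add: lemniscate_convex_def f')
qed

theorem theorem2p8:
  fixes \<mu> p :: real
  assumes "\<not> negative_odd_integer (\<mu> + p)"
    and "\<not> negative_odd_integer (\<mu> - p)"
    and "3 * \<mu> / (2 * sqrt 2) - sqrt 3 * \<bar>((\<mu> + 1)\<^sup>2 - p\<^sup>2) / 4 - 2 * \<mu> - 2\<bar>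
           > 13 * sqrt 3 / 4 - 15 / (8 * sqrt 2) + 1 / 4"
  shows "lemniscate_convex (alexander_transform (lommel_h \<mu> p))"
proof -
  define K where "K = (\<mu> - p + 3) / 2"
  define F where "F = (\<mu> + p + 3) / 2"
  define X where "X = ((\<mu> + 1)\<^sup>2 - p\<^sup>2) / 4 - 2 * \<mu> - 2"
  have KF_X: "K * F = X + 3 * \<mu> + 4"
    by (simp add: K_def F_def X_def power2_eq_square field_simps)
  have sqrt2: "7 / 5 \<le> sqrt 2" and sqrt3: "3 / 2 \<le> sqrt 3"
    by (rule real_le_rsqrt; simp add: power2_eq_square)+
  \<comment> \<open>With \<open>sqrt3\<close>, this rough bound makes the right-hand side of the
    assumed inequality positive.\<close>
  have "15 / (8 * sqrt 2) \<le> 15 / 8"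
    by (simp add: field_simps)
  then have less: "sqrt 3 * \<bar>X\<bar> < 3 * \<mu> / (2 * sqrt 2)"
    using assms(3) sqrt3 unfolding X_def by linarith
  have "0 \<le> sqrt 3 * \<bar>X\<bar>" by simp
  then have "0 < 3 * \<mu> / (2 * sqrt 2)" using less by linarith
  then have \<mu>_pos: "0 < \<mu>" by (simp add: zero_less_divide_iff)
  have "3 / 2 * \<bar>X\<bar> \<le> sqrt 3 * \<bar>X\<bar>"
    using sqrt3 by (intro mult_right_mono) auto
  moreover have "3 * \<mu> / (2 * sqrt 2) \<le> 3 * \<mu> / 2"
    using \<mu>_pos by (intro divide_left_mono) auto
  ultimately have "\<bar>X\<bar> < \<mu>" using less by linarith
  \<comment> \<open>From \<open>X > -\<mu>\<close> follows
    \<open>K * F > 2 * \<mu> + 4\<close>.\<close>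
  then have KF: "4 \<le> K * F" using KF_X \<mu>_pos by linarith
  moreover have "0 < K + F" using \<mu>_pos by (simp add: K_def F_def field_simps)
  ultimately have K: "0 < K" and F: "0 < F"
    using mult_nonneg_nonpos[of K F] mult_nonneg_nonpos[of F K]
    by (smt (verit) mult.commute)+

  \<comment> \<open>These are the coefficients of \<open>h z / z\<close>, so \<open>a 0 = 1\<close>
    is the leading term that \<open>lommel_h\<close> writes separately.\<close>
  define a where "a n = (- 1 / 4) ^ n / (pochhammer (complex_of_real K) n * pochhammer (complex_of_real F) n)" for n
  have norm_a: "norm (a n) \<le> (1 / 16) ^ n" for n
  proof -
    have "4 ^ n \<le> (K * F) ^ n"
      using KF by (intro power_mono) auto
    also have "\<dots> \<le> pochhammer K n * pochhammer F n"
      unfolding power_mult_distrib using K F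
      by (intro mult_mono power_le_pochhammer pochhammer_nonneg) auto
    finally have le: "4 ^ n \<le> pochhammer K n * pochhammer F n" .
    have "norm (a n) = (1 / 4) ^ n / (pochhammer K n * pochhammer F n)"
      using K F
      by (simp add: a_def pochhammer_of_real norm_divide norm_mult norm_power pochhammer_nonneg)
    also have "\<dots> \<le> (1 / 4) ^ n / 4 ^ n"
      using le by (intro divide_left_mono mult_pos_pos) (auto intro: pochhammer_pos K F)
    finally show ?thesis by (simp flip: power_divide)
  qed
  have norm_term: "norm (a n * z ^ n) \<le> (norm z / 16) ^ n" for n z
    using mult_right_mono[OF norm_a[of n], of "norm z ^ n"]
    by (simp add: norm_mult norm_power power_divide)
  have summable: "summable (\<lambda>n. a n * z ^ n)" if "norm z < 16" for z
    by (rule summable_comparison_test'[OF summable_geometric norm_term]) (use that in auto)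
  define g where "g z = (\<Sum>n. a n * z ^ n)" for z
  have g_split: "g z = 1 + (\<Sum>n. a (Suc n) * z ^ Suc n)" if "norm z < 16" for z
    using suminf_split_head[OF summable[OF that]] by (simp add: g_def a_def)
  show ?thesis
  proof (rule lemniscate_convex_alexander_transform)
    show "g holomorphic_on ball 0 3"
      by (rule power_series_holomorphic[of _ _ a]) (auto simp: g_def intro!: summable_sums summable)
    show "g 0 = 1" using g_split[of 0] by simp
  next
    fix z :: complex assume "z \<in> cball 0 2"
    then have z: "norm z \<le> 2" by simp
    have bnd: "norm (a (Suc n) * z ^ Suc n) \<le> 1 / 8 * (1 / 8) ^ n" for n
    proof -
      have "norm (a (Suc n) * z ^ Suc n) \<le> (norm z / 16) ^ Suc n" by (rule norm_term)
      also have "\<dots> \<le> (1 / 8) ^ Suc n" using z by (intro power_mono) auto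
      finally show ?thesis by simp
    qed
    \<comment> \<open>For \<open>norm z\<close> at most \<open>2\<close> the ratio is
      \<open>2 / 16 = 1 / 8\<close>, and the series without its constant term is bounded by
      \<open>1 / 7\<close>.\<close>
    have "(\<lambda>n. 1 / 8 * (1 / 8) ^ n) sums (1 / 8 * (1 / (1 - 1 / 8 :: real)))"
      by (intro sums_mult geometric_sums) simp
    then have "norm (\<Sum>n. a (Suc n) * z ^ Suc n) \<le> 1 / 8 * (1 / (1 - 1 / 8))"
      using norm_suminf_le[of "\<lambda>n. a (Suc n) * z ^ Suc n", OF bnd] by (simp only: sums_iff)
    then show "norm (g z - 1) \<le> 1 / 7" using g_split[of z] z by simp
  next
    fix z :: complex assume "z \<in> unit_disc"
    then have z: "norm z < 16" by simp
    have "summable (\<lambda>n. a (Suc n) * z ^ Suc n)"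
      using summable[OF z] by (subst summable_Suc_iff)
    then have "z * (\<Sum>n. a (Suc n) * z ^ Suc n) = (\<Sum>n. a (Suc n) * z ^ (Suc n + 1))"
      by (subst suminf_mult[symmetric]) (simp_all add: mult_ac)
    then show "lommel_h \<mu> p z = z * g z"
      by (simp add: g_split[OF z] lommel_h_def a_def K_def F_def distrib_left)
  qed
qed

end
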